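(* Let $(X,\mathcal{L}_X)$ be a locally small space and $Y\subseteq X$. The subspace $(Y,\mathcal{L}_X\cap_1 Y)$ of the locally small space $(X,\mathcal{L}_X)$ induced by $Y$, where $\mathcal{L}_X\cap_1Y=\{L\cap Y:L\in\mathcal{L}_X\}$, is, after identification of locally small spaces with generalized topological spaces, the same as the subspace induced by $Y$ in the generalized topological space $(X,\mathcal{L}_X^o,EF(\mathcal{L}_X^o,\mathcal{L}_X))$ as an object of $\mathbf{GTS}$. That is, $$\langle EF(\mathcal{L}_X^o,\mathcal{L}_X)\cap_2 Y\rangle_Y=EF\big((\mathcal{L}_X\cap_1Y)^o,\ \mathcal{L}_X\cap_1Y\big),$$ where $(\mathcal{L}_X\cap_1Y)^o$ is formed in $Y$.
   Context: A locally small space is a pair $(X,\mathcal{L}_X)$ with $X$ a set and $\mathcal{L}_X\subseteq\mathcal{P}(X)$ such that $\emptyset\in\mathcal{L}_X$, $L\cap M,L\cup M\in\mathcal{L}_X$ for all $L,M\in\mathcal{L}_X$, and $\bigcup\mathcal{L}_X=X$. For a family $\mathcal{A}\subseteq\mathcal{P}(X)$, $\mathcal{A}^o=\{V\subseteq X:V\cap A\in\mathcal{A}\text{ for all }A\in\mathcal{A}\}$. A family $\mathcal{U}$ of sets is essentially finite if some finite subfamily has the same union as $\mathcal{U}$; it is essentially finite on a set $S$ if $\mathcal{U}\cap_1S=\{U\cap S:U\in\mathcal{U}\}$ is essentially finite. $EF(\mathcal{U},\mathcal{V})$ denotes the family of all subfamilies of $\mathcal{U}$ that are essentially finite on every member of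 $\mathcal{V}$. For families of sets, $\mathcal{U}\cap_1\mathcal{V}=\{U\cap V:U\in\mathcal{U},V\in\mathcal{V}\}$. For a family of families $\Phi$, $\Phi\cap_2Y=\{\mathcal{U}\cap_1Y:\mathcal{U}\in\Phi\}$. A (Delfs-Knebusch) generalized topological space (gts) is a triple $(X,Op_X,Cov_X)$ with $Op_X\subseteq\mathcal{P}(X)$ (open sets), $Cov_X\subseteq\mathcal{P}(Op_X)$ (admissible families) such that: (finiteness) if $\mathcal{U}\subseteq Op_X$ is finite, then $\mathcal{U}\in Cov_X$ and $\bigcup\mathcal{U},\bigcap\mathcal{U}\in Op_X$ (with $\bigcap\emptyset=X$); (stability) if $V\in Op_X$ and $\mathcal{U}\in Cov_X$, then $V\cap_1\mathcal{U}=\{V\cap U:U\in\mathcal{U}\}\in Cov_X$; (transitivity) if $\mathcal{U}\in Cov_X$ and, for each $U\in\mathcal{U}$, $\mathcal{V}(U)\in Cov_X$ with $\bigcup\mathcal{V}(U)=U$, then $\bigcup_{U\in\mathcal{U}}\mathcal{V}(U)\in Cov_X$; (saturation) if $\mathcal{U}\in Cov_X$, $\mathcal{V}\subseteq Op_X$, $\bigcup\mathcal{U}=\bigcup\mathcal{V}$ and each member of $\mathcal{U}$ is contained in a member of $\mathcal{V}$, then $\mathcal{V}\in Cov_X$; (regularity) if $\mathcal{U}\in Cov_X$, $W\subseteq\bigcup\mathcal{U}$ and $W\cap_1\mathcal{U}\subseteq Op_X$, then $W\in Op_X$. Then $Op_X=\bigcup Cov_X$, so the gts is determined by $Cov_X$,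 which is called a generalized topology on $X$. $\mathbf{GTS}$ is the category of gtses and mappings under which preimages of admissible families are admissible. For $\Psi\subseteq\mathcal{P}(\mathcal{P}(X))$, $\langle\Psi\rangle_X$ is the smallest generalized topology on $X$ containing $\Psi$. The subspace of a gts $(X,Op_X,Cov_X)$ induced by $Y\subseteq X$ in $\mathbf{GTS}$ is the gts on $Y$ whose generalized topology is $\langle Cov_X\cap_2Y\rangle_Y$. Identification: a locally small space $(X,\mathcal{L}_X)$ is identified with the gts $(X,\mathcal{L}_X^o,EF(\mathcal{L}_X^o,\mathcal{L}_X))$. *)

theory Defs
  imports Main
begin

locale locally_small_space =
  fixes X :: "'a set" and L :: "'a set set"
  assumes subsets: "L \<subseteq> Pow X"
    and empty: "{} \<in> L"
    and inter: "\<And>A B. A \<in> L \<Longrightarrow> B \<in> L \<Longrightarrow> A \<inter> B \<in> L"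
    and union: "\<And>A B. A \<in> L \<Longrightarrow> B \<in> L \<Longrightarrow> A \<union> B \<in> L"
    and covers: "\<Union>L = X"

definition trace1 :: "'a set set \<Rightarrow> 'a set \<Rightarrow> 'a set set"  (infixl "\<inter>\<^sub>1" 70)
  where "\<U> \<inter>\<^sub>1 S = {U \<inter> S |U. U \<in> \<U>}"

definition trace2 :: "'a set set set \<Rightarrow> 'a set \<Rightarrow> 'a set set set"  (infixl "\<inter>\<^sub>2" 70)
  where "\<Phi> \<inter>\<^sub>2 Y = {\<U> \<inter>\<^sub>1 Y |\<U>. \<U> \<in> \<Phi>}"

text \<open>The family \<open>A\<^sup>o\<close>. It depends on the ambient set \<open>X\<close>, which is therefore an argument.\<close>

definition compatible_sets :: "'a set \<Rightarrow> 'a set set \<Rightarrow> 'a set set"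
  where "compatible_sets X \<A> = {V. V \<subseteq> X \<and> (\<forall>A\<in>\<A>. V \<inter> A \<in> \<A>)}"

definition ess_finite :: "'a set set \<Rightarrow> bool"
  where "ess_finite \<U> \<longleftrightarrow> (\<exists>\<F>. \<F> \<subseteq> \<U> \<and> finite \<F> \<and> \<Union>\<F> = \<Union>\<U>)"

definition ess_finite_on :: "'a set set \<Rightarrow> 'a set \<Rightarrow> bool"
  where "ess_finite_on \<U> S \<longleftrightarrow> ess_finite (\<U> \<inter>\<^sub>1 S)"

definition EF :: "'a set set \<Rightarrow> 'a set set \<Rightarrow> 'a set set set"
  where "EF \<U> \<V> = {\<W>. \<W> \<subseteq> \<U> \<and> (\<forall>S\<in>\<V>. ess_finite_on \<W> S)}"

text \<open>In \<open>finiteness_Inter\<close> the intersection with \<open>X\<close> implements the convention that the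
  empty intersection is \<open>X\<close>.\<close>

locale gts =
  fixes X :: "'a set" and Op :: "'a set set" and Cov :: "'a set set set"
  assumes Op_subsets: "Op \<subseteq> Pow X"
    and Cov_subsets: "Cov \<subseteq> Pow Op"
    and finiteness_Cov: "\<And>\<U>. \<U> \<subseteq> Op \<Longrightarrow> finite \<U> \<Longrightarrow> \<U> \<in> Cov"
    and finiteness_Union: "\<And>\<U>. \<U> \<subseteq> Op \<Longrightarrow> finite \<U> \<Longrightarrow> \<Union>\<U> \<in> Op"
    and finiteness_Inter: "\<And>\<U>. \<U> \<subseteq> Op \<Longrightarrow> finite \<U> \<Longrightarrow> X \<inter> \<Inter>\<U> \<in> Op"
    and stability: "\<And>V \<U>. V \<in> Op \<Longrightarrow> \<U> \<in> Cov \<Longrightarrow> \<U> \<inter>\<^sub>1 V \<in> Cov"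
    and transitivity: "\<And>\<U> \<V>. \<U> \<in> Cov \<Longrightarrow> (\<And>U. U \<in> \<U> \<Longrightarrow> \<V> U \<in> Cov \<and> \<Union>(\<V> U) = U)
      \<Longrightarrow> (\<Union>U\<in>\<U>. \<V> U) \<in> Cov"
    and saturation: "\<And>\<U> \<V>. \<U> \<in> Cov \<Longrightarrow> \<V> \<subseteq> Op \<Longrightarrow> \<Union>\<U> = \<Union>\<V>
      \<Longrightarrow> (\<And>U. U \<in> \<U> \<Longrightarrow> \<exists>V\<in>\<V>. U \<subseteq> V) \<Longrightarrow> \<V> \<in> Cov"
    and regularity: "\<And>\<U> W. \<U> \<in> Cov \<Longrightarrow> W \<subseteq> \<Union>\<U> \<Longrightarrow> \<U> \<inter>\<^sub>1 W \<subseteq> Op \<Longrightarrow> W \<in> Op"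

definition generalized_topology :: "'a set \<Rightarrow> 'a set set set \<Rightarrow> bool"
  where "generalized_topology X Cov \<longleftrightarrow> (\<exists>Op. gts X Op Cov)"

lemma (in gts) singleton_Cov_iff: "{V} \<in> Cov \<longleftrightarrow> V \<in> Op"
  using finiteness_Cov[of "{V}"] Cov_subsets by auto

lemma (in gts) Op_eq_Union_Cov: "Op = \<Union>Cov"
  using singleton_Cov_iff Cov_subsets by blast

definition generated_gt :: "'a set \<Rightarrow> 'a set set set \<Rightarrow> 'a set set set"
  where "generated_gt X \<Psi> = (LEAST Cov. generalized_topology X Cov \<and> \<Psi> \<subseteq> Cov)"

text \<open>The least element in \<open>generated_gt\<close> exists: it is the intersection of all
  generalized topologies on \<open>X\<close> that contain \<open>\<Psi>\<close>.\<close>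

lemma generalized_topology_Pow: "generalized_topology X (Pow (Pow X))"
proof -
  have "gts X (Pow X) (Pow (Pow X))"
  proof
    fix \<U> :: "'a set set" and \<V>
    assume "\<U> \<in> Pow (Pow X)" "\<And>U. U \<in> \<U> \<Longrightarrow> \<V> U \<in> Pow (Pow X) \<and> \<Union>(\<V> U) = U"
    then show "(\<Union>U\<in>\<U>. \<V> U) \<in> Pow (Pow X)"
      by (simp add: UN_least)
  next
    fix \<U> :: "'a set set" and W
    assume "\<U> \<in> Pow (Pow X)" "W \<subseteq> \<Union>\<U>"
    then show "W \<in> Pow X"
      by blast
  next
    fix \<U> \<V> :: "'a set set"
    assume "\<V> \<subseteq> Pow X"
    then show "\<V> \<in> Pow (Pow X)"
      by simp
  next
    fix \<U> :: "'a set set" and V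
    assume "V \<in> Pow X"
    then show "\<U> \<inter>\<^sub>1 V \<in> Pow (Pow X)"
      unfolding trace1_def by blast
  qed blast+
  then show ?thesis
    unfolding generalized_topology_def by blast
qed

lemma generalized_topology_Inter:
  assumes ne: "\<C> \<noteq> {}" and gt: "\<And>Cov. Cov \<in> \<C> \<Longrightarrow> generalized_topology X Cov"
  shows "generalized_topology X (\<Inter>\<C>)"
proof -
  define Op where "Op = (\<Inter>Cov\<in>\<C>. \<Union>Cov)"
  have g: "gts X (\<Union>Cov) Cov" if C: "Cov \<in> \<C>" for Cov
  proof -
    obtain Op' where o: "gts X Op' Cov"
      using gt[OF C] unfolding generalized_topology_def by blast
    then show ?thesis
      using gts.Op_eq_Union_Cov[OF o] by simp
  qed
  have Op_sub: "Op \<subseteq> \<Union>Cov" if "Cov \<in> \<C>" for Cov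
    using that unfolding Op_def by blast
  have OpI: "W \<in> Op" if "\<And>Cov. Cov \<in> \<C> \<Longrightarrow> W \<in> \<Union>Cov" for W
    using that unfolding Op_def by blast
  have "gts X Op (\<Inter>\<C>)"
  proof
    show "Op \<subseteq> Pow X"
    proof -
      obtain Cov where C: "Cov \<in> \<C>"
        using ne by blast
      show ?thesis
        by (rule subset_trans[OF Op_sub[OF C] gts.Op_subsets[OF g[OF C]]])
    qed
    show "\<Inter>\<C> \<subseteq> Pow Op"
      unfolding Op_def by blast
    fix \<U> :: "'a set set"
    assume U: "\<U> \<subseteq> Op" "finite \<U>"
    then have sub: "\<U> \<subseteq> \<Union>Cov" if "Cov \<in> \<C>" for Cov
      using Op_sub that by blast
    show "\<U> \<in> \<Inter>\<C>"
      by (rule InterI) (rule gts.finiteness_Cov[OF g sub U(2)])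
    show "\<Union>\<U> \<in> Op"
      by (rule OpI) (rule gts.finiteness_Union[OF g sub U(2)])
    show "X \<inter> \<Inter>\<U> \<in> Op"
      by (rule OpI) (rule gts.finiteness_Inter[OF g sub U(2)])
  next
    fix V \<U> assume a: "V \<in> Op" "\<U> \<in> \<Inter>\<C>"
    show "\<U> \<inter>\<^sub>1 V \<in> \<Inter>\<C>"
    proof
      fix Cov assume C: "Cov \<in> \<C>"
      show "\<U> \<inter>\<^sub>1 V \<in> Cov"
        by (rule gts.stability[OF g[OF C] subsetD[OF Op_sub[OF C]]]) (use a C in simp_all)
    qed
  next
    fix \<U> :: "'a set set" and \<V>
    assume a: "\<U> \<in> \<Inter>\<C>" "\<And>U. U \<in> \<U> \<Longrightarrow> \<V> U \<in> \<Inter>\<C> \<and> \<Union>(\<V> U) = U"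
    show "(\<Union>U\<in>\<U>. \<V> U) \<in> \<Inter>\<C>"
    proof
      fix Cov assume C: "Cov \<in> \<C>"
      show "(\<Union>U\<in>\<U>. \<V> U) \<in> Cov"
        by (rule gts.transitivity[OF g[OF C]]) (use a C in blast)+
    qed
  next
    fix \<U> \<V> :: "'a set set"
    assume a: "\<U> \<in> \<Inter>\<C>" "\<V> \<subseteq> Op" "\<Union>\<U> = \<Union>\<V>" "\<And>U. U \<in> \<U> \<Longrightarrow> \<exists>V\<in>\<V>. U \<subseteq> V"
    show "\<V> \<in> \<Inter>\<C>"
    proof
      fix Cov assume C: "Cov \<in> \<C>"
      show "\<V> \<in> Cov"
      proof (rule gts.saturation[OF g[OF C]])
        show "\<U> \<in> Cov" "\<V> \<subseteq> \<Union>Cov"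
          using a(1,2) C Op_sub[OF C] by blast+
      qed (fact a(3,4))+
    qed
  next
    fix \<U> W assume a: "\<U> \<in> \<Inter>\<C>" "W \<subseteq> \<Union>\<U>" "\<U> \<inter>\<^sub>1 W \<subseteq> Op"
    show "W \<in> Op"
    proof (rule OpI)
      fix Cov assume C: "Cov \<in> \<C>"
      show "W \<in> \<Union>Cov"
      proof (rule gts.regularity[OF g[OF C]])
        show "\<U> \<in> Cov" "\<U> \<inter>\<^sub>1 W \<subseteq> \<Union>Cov"
          using a(1,3) C Op_sub[OF C] by blast+
      qed (fact a(2))
    qed
  qed
  then show ?thesis
    unfolding generalized_topology_def by blast
qed

lemma generated_gt_eq_Inter:
  assumes "\<Psi> \<subseteq> Pow (Pow X)"
  shows "generated_gt X \<Psi> = \<Inter>{Cov. generalized_topology X Cov \<and> \<Psi> \<subseteq> Cov}"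
  unfolding generated_gt_def
proof (rule Least_equality)
  show "generalized_topology X (\<Inter>{Cov. generalized_topology X Cov \<and> \<Psi> \<subseteq> Cov})
    \<and> \<Psi> \<subseteq> \<Inter>{Cov. generalized_topology X Cov \<and> \<Psi> \<subseteq> Cov}"
    using generalized_topology_Pow[of X] assms
    by (intro conjI generalized_topology_Inter) blast+
qed blast

text \<open>Spaces as objects: a locally small space is a pair \<open>(X, L)\<close>, a gts is a triple
  \<open>(X, Op, Cov)\<close>. The subspace of a gts is given by its generalized topology alone, and
  its open sets are recovered as the union of it (see \<open>gts.Op_eq_Union_Cov\<close>).\<close>

fun lss_subspace :: "'a set \<times> 'a set set \<Rightarrow> 'a set \<Rightarrow> 'a set \<times> 'a set set"
  where "lss_subspace (X, L) Y = (Y, L \<inter>\<^sub>1 Y)"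

fun lss_to_gts :: "'a set \<times> 'a set set \<Rightarrow> 'a set \<times> 'a set set \<times> 'a set set set"
  where "lss_to_gts (X, L) = (X, compatible_sets X L, EF (compatible_sets X L) L)"

fun gts_subspace ::
  "'a set \<times> 'a set set \<times> 'a set set set \<Rightarrow> 'a set \<Rightarrow> 'a set \<times> 'a set set \<times> 'a set set set"
  where "gts_subspace (X, Op, Cov) Y =
    (Y, \<Union>(generated_gt Y (Cov \<inter>\<^sub>2 Y)), generated_gt Y (Cov \<inter>\<^sub>2 Y))"

end

theory Submission
  imports Defs
begin

text \<open>
  Put \<open>K = L \<inter>\<^sub>1 Y\<close>. The pair \<open>(Y, K)\<close> is again a locally small space, so the claim is that
  \<open>EF (K\<^sup>o) K\<close> is the least generalized topology on \<open>Y\<close> that contains the traces on \<open>Y\<close> of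
  the families in \<open>EF (L\<^sup>o) L\<close>.

  It is a generalized topology (\<open>gts_compatible_EF\<close>) because openness and admissibility are
  conditions inside each member of \<open>K\<close>, where an admissible family may be replaced by a finite
  one. The axioms on open sets then reduce to the closure of \<open>K\<close> under finite unions and
  intersections, the axioms on families to combining finitely many finite families. It contains
  the traces because intersecting with \<open>Y\<close> preserves both conditions (\<open>trace_EF_subset\<close>).

  It is the least one because of a single admissible family: \<open>L\<close> itself lies in \<open>EF (L\<^sup>o) L\<close>, so
  \<open>K\<close> is an admissible covering of \<open>Y\<close> in every competitor. In a gts in which \<open>K\<close> is
  admissible, regularity glues each member of \<open>K\<^sup>o\<close> from its pieces inside the members of \<open>K\<close>,
  and transitivity glues each family in \<open>EF (K\<^sup>o) K\<close> from finite families inside the members of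
  \<open>K\<close> (\<open>EF_subset_Cov_if_admissible\<close>).
\<close>

section \<open>Traces and essential finiteness\<close>

lemma Union_trace1: "\<Union>(\<U> \<inter>\<^sub>1 S) = \<Union>\<U> \<inter> S"
  unfolding trace1_def by blast

lemma trace1_eq_image: "\<U> \<inter>\<^sub>1 S = (\<lambda>U. U \<inter> S) ` \<U>"
  unfolding trace1_def by blast

lemma mem_trace1I: "U \<in> \<U> \<Longrightarrow> U \<inter> S \<in> \<U> \<inter>\<^sub>1 S"
  unfolding trace1_def by blast

lemma mem_trace1E:
  assumes "A \<in> \<U> \<inter>\<^sub>1 S"
  obtains U where "U \<in> \<U>" "A = U \<inter> S"
  using assms unfolding trace1_def by blast

text \<open>Lifting the finitely many traces to members of the family makes it possible to restrict
  the same finite subfamily to smaller sets.\<close>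

lemma ess_finite_on_iff:
  "ess_finite_on \<U> S \<longleftrightarrow> (\<exists>\<F>. \<F> \<subseteq> \<U> \<and> finite \<F> \<and> \<Union>\<F> \<inter> S = \<Union>\<U> \<inter> S)"
proof -
  have "ess_finite_on \<U> S \<longleftrightarrow>
      (\<exists>\<G>. finite \<G> \<and> \<G> \<subseteq> (\<lambda>U. U \<inter> S) ` \<U> \<and> \<Union>\<G> = \<Union>\<U> \<inter> S)"
    unfolding ess_finite_on_def ess_finite_def Union_trace1
    unfolding trace1_eq_image by (simp only: conj_ac)
  also have "\<dots> \<longleftrightarrow> (\<exists>\<F>. finite \<F> \<and> \<F> \<subseteq> \<U> \<and> \<Union>(\<F> \<inter>\<^sub>1 S) = \<Union>\<U> \<inter> S)"
    unfolding trace1_eq_image by (rule ex_finite_subset_image)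
  finally show ?thesis
    unfolding Union_trace1 by (simp only: conj_ac)
qed

lemma EF_obtain:
  assumes "\<U> \<in> EF \<O> \<V>" "S \<in> \<V>"
  obtains \<F> where "\<F> \<subseteq> \<U>" "finite \<F>" "\<Union>\<F> \<inter> S = \<Union>\<U> \<inter> S"
proof -
  have "\<exists>\<F>. \<F> \<subseteq> \<U> \<and> finite \<F> \<and> \<Union>\<F> \<inter> S = \<Union>\<U> \<inter> S"
    using assms by (simp add: EF_def ess_finite_on_iff)
  then show ?thesis by (elim exE conjE) (rule that)
qed

lemma EF_I:
  assumes "\<U> \<subseteq> \<O>"
    and "\<And>S. S \<in> \<V> \<Longrightarrow> \<exists>\<F>. \<F> \<subseteq> \<U> \<and> finite \<F> \<and> \<Union>\<F> \<inter> S = \<Union>\<U> \<inter> S"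
  shows "\<U> \<in> EF \<O> \<V>"
  using assms by (simp add: EF_def ess_finite_on_iff)

lemma EF_subset: "\<U> \<in> EF \<O> \<V> \<Longrightarrow> \<U> \<subseteq> \<O>"
  unfolding EF_def by blast

text \<open>Cutting the members of a family with \<open>T\<close> and the test set with \<open>R\<close> keeps the same finite
  subfamily. For \<open>R = UNIV\<close> this is the stability axiom, for \<open>R = T = Y\<close> the passage to a
  subspace.\<close>

lemma ess_finite_on_trace1:
  assumes "ess_finite_on \<U> S"
  shows "ess_finite_on (\<U> \<inter>\<^sub>1 T) (S \<inter> R)"
proof -
  obtain \<F> where F: "\<F> \<subseteq> \<U>" "finite \<F>" "\<Union>\<F> \<inter> S = \<Union>\<U> \<inter> S"
    using assms unfolding ess_finite_on_iff by (elim exE conjE)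
  have "\<F> \<inter>\<^sub>1 T \<subseteq> \<U> \<inter>\<^sub>1 T" "finite (\<F> \<inter>\<^sub>1 T)"
    using F(1,2) by (auto simp: trace1_def)
  moreover have "(\<Union>\<F> \<inter> S) \<inter> (T \<inter> R) = (\<Union>\<U> \<inter> S) \<inter> (T \<inter> R)"
    by (simp only: F(3))
  then have "\<Union>(\<F> \<inter>\<^sub>1 T) \<inter> (S \<inter> R) = \<Union>(\<U> \<inter>\<^sub>1 T) \<inter> (S \<inter> R)"
    unfolding Union_trace1 by (simp only: Int_ac)
  ultimately show ?thesis
    unfolding ess_finite_on_iff by (intro exI conjI)
qed

section \<open>Locally small spaces as generalized topological spaces\<close>

lemma compatible_setsI:
  "V \<subseteq> X \<Longrightarrow> (\<And>A. A \<in> \<A> \<Longrightarrow> V \<inter> A \<in> \<A>) \<Longrightarrow> V \<in> compatible_sets X \<A>"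
  unfolding compatible_sets_def by blast

lemma compatible_sets_subset: "V \<in> compatible_sets X \<A> \<Longrightarrow> V \<subseteq> X"
  unfolding compatible_sets_def by blast

lemma compatible_sets_Int: "V \<in> compatible_sets X \<A> \<Longrightarrow> A \<in> \<A> \<Longrightarrow> V \<inter> A \<in> \<A>"
  unfolding compatible_sets_def by blast

context locally_small_space
begin

lemma subset_compatible_sets: "L \<subseteq> compatible_sets X L"
proof
  fix A assume "A \<in> L"
  then show "A \<in> compatible_sets X L"
    using subsets by (intro compatible_setsI inter) auto
qed

lemma finite_Union_closed: "finite \<F> \<Longrightarrow> \<F> \<subseteq> L \<Longrightarrow> \<Union>\<F> \<in> L"
  by (induction rule: finite_induct) (auto intro: empty union)

lemma finite_Union_Int_closed:
  assumes "finite \<F>" "\<And>U. U \<in> \<F> \<Longrightarrow> U \<inter> A \<in> L"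
  shows "\<Union>\<F> \<inter> A \<in> L"
proof -
  have "(\<Union>U\<in>\<F>. U \<inter> A) \<in> L"
    using assms by (intro finite_Union_closed) auto
  then show ?thesis by (simp only: Int_Union2)
qed

lemma compatible_finite_Inter:
  assumes "finite \<U>" "\<U> \<subseteq> compatible_sets X L"
  shows "X \<inter> \<Inter>\<U> \<in> compatible_sets X L"
  using assms
proof (induction rule: finite_induct)
  case empty
  have "X \<inter> A = A" if "A \<in> L" for A using subsets that by blast
  then show ?case by (simp add: compatible_sets_def)
next
  case (insert U \<F>)
  have U: "U \<in> compatible_sets X L" and F: "X \<inter> \<Inter>\<F> \<in> compatible_sets X L"
    using insert by auto
  show ?case
  proof (rule compatible_setsI)
    fix A assume "A \<in> L"
    then have "U \<inter> (X \<inter> \<Inter>\<F> \<inter> A) \<in> L"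
      by (intro compatible_sets_Int[OF U] compatible_sets_Int[OF F])
    moreover have "X \<inter> \<Inter>(insert U \<F>) \<inter> A = U \<inter> (X \<inter> \<Inter>\<F> \<inter> A)"
      by (simp add: Int_ac)
    ultimately show "X \<inter> \<Inter>(insert U \<F>) \<inter> A \<in> L" by simp
  qed blast
qed

text \<open>Inside a member of \<open>L\<close> the union is a finite one. This gives the union axiom for finite
  families, and regularity as well, since there the set in question is the union of its
  traces on an admissible family.\<close>

lemma compatible_Union_EF:
  assumes "\<U> \<in> EF (compatible_sets X L) L"
  shows "\<Union>\<U> \<in> compatible_sets X L"
proof (rule compatible_setsI)
  show "\<Union>\<U> \<subseteq> X"
    using EF_subset[OF assms] compatible_sets_subset by blast
  fix A assume A: "A \<in> L"
  obtain \<F> where F: "\<F> \<subseteq> \<U>" "finite \<F>" "\<Union>\<F> \<inter> A = \<Union>\<U> \<inter> A"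
    using EF_obtain[OF assms A] .
  have "\<Union>\<F> \<inter> A \<in> L"
  proof (rule finite_Union_Int_closed[OF F(2)])
    fix U assume "U \<in> \<F>"
    then have "U \<in> compatible_sets X L"
      using F(1) EF_subset[OF assms] by blast
    then show "U \<inter> A \<in> L"
      using A by (rule compatible_sets_Int)
  qed
  then show "\<Union>\<U> \<inter> A \<in> L" using F(3) by simp
qed

lemma trace1_in_EF:
  assumes "\<U> \<in> EF (compatible_sets X L) L" "\<U> \<inter>\<^sub>1 V \<subseteq> compatible_sets X L"
  shows "\<U> \<inter>\<^sub>1 V \<in> EF (compatible_sets X L) L"
  using assms ess_finite_on_trace1[of \<U> _ V UNIV] unfolding EF_def by simp

lemma finite_in_EF:
  assumes "\<U> \<subseteq> \<O>" "finite \<U>"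
  shows "\<U> \<in> EF \<O> \<V>"
  using assms by (intro EF_I exI[of _ \<U>]) simp_all

lemma gts_compatible_EF: "gts X (compatible_sets X L) (EF (compatible_sets X L) L)"
proof
  show "compatible_sets X L \<subseteq> Pow X"
    using compatible_sets_subset by blast
  show "EF (compatible_sets X L) L \<subseteq> Pow (compatible_sets X L)"
    using EF_subset by blast
  fix \<U> assume U: "\<U> \<subseteq> compatible_sets X L" "finite \<U>"
  show "\<U> \<in> EF (compatible_sets X L) L"
    using U by (rule finite_in_EF)
  then show "\<Union>\<U> \<in> compatible_sets X L"
    by (rule compatible_Union_EF)
  show "X \<inter> \<Inter>\<U> \<in> compatible_sets X L"
    using U(2,1) by (rule compatible_finite_Inter)
next
  fix V \<U> assume V: "V \<in> compatible_sets X L" and U: "\<U> \<in> EF (compatible_sets X L) L"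
  show "\<U> \<inter>\<^sub>1 V \<in> EF (compatible_sets X L) L"
  proof (rule trace1_in_EF[OF U], rule subsetI)
    fix W assume "W \<in> \<U> \<inter>\<^sub>1 V"
    then obtain T where T: "T \<in> \<U>" "W = T \<inter> V" by (rule mem_trace1E)
    then have "T \<in> compatible_sets X L" using EF_subset[OF U] by blast
    then show "W \<in> compatible_sets X L"
      using V unfolding T(2) compatible_sets_def by (auto simp: Int_assoc)
  qed
next
  fix \<U> and \<V> :: "'a set \<Rightarrow> 'a set set"
  assume U: "\<U> \<in> EF (compatible_sets X L) L"
    and V: "\<And>U. U \<in> \<U> \<Longrightarrow> \<V> U \<in> EF (compatible_sets X L) L \<and> \<Union>(\<V> U) = U"
  show "(\<Union>U\<in>\<U>. \<V> U) \<in> EF (compatible_sets X L) L"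
  proof (rule EF_I)
    show "(\<Union>U\<in>\<U>. \<V> U) \<subseteq> compatible_sets X L"
      using V by (intro UN_least EF_subset[of _ _ L]) simp
    fix S assume S: "S \<in> L"
    obtain \<F> where F: "\<F> \<subseteq> \<U>" "finite \<F>" "\<Union>\<F> \<inter> S = \<Union>\<U> \<inter> S"
      using EF_obtain[OF U S] .
    have "\<exists>\<G>. \<G> \<subseteq> \<V> U \<and> finite \<G> \<and> \<Union>\<G> \<inter> S = U \<inter> S" if "U \<in> \<U>" for U
    proof -
      have VU: "\<V> U \<in> EF (compatible_sets X L) L" "\<Union>(\<V> U) = U"
        using V[OF that] by simp_all
      obtain \<G> where "\<G> \<subseteq> \<V> U" "finite \<G>" "\<Union>\<G> \<inter> S = \<Union>(\<V> U) \<inter> S"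
        using EF_obtain[OF VU(1) S] .
      then show ?thesis unfolding VU(2) by (intro exI conjI)
    qed
    then obtain \<G> where G:
      "\<And>U. U \<in> \<U> \<Longrightarrow> \<G> U \<subseteq> \<V> U \<and> finite (\<G> U) \<and> \<Union>(\<G> U) \<inter> S = U \<inter> S"
      by metis
    have "\<Union>(\<Union>U\<in>\<F>. \<G> U) \<inter> S = (\<Union>U\<in>\<F>. \<Union>(\<G> U) \<inter> S)" by blast
    also have "\<dots> = (\<Union>U\<in>\<F>. U \<inter> S)"
    proof (rule SUP_cong[OF refl])
      fix U assume "U \<in> \<F>"
      then show "\<Union>(\<G> U) \<inter> S = U \<inter> S" using F(1) G by (meson subsetD)
    qed
    also have "\<dots> = \<Union>\<F> \<inter> S" by blast
    also have "\<dots> = (\<Union>U\<in>\<U>. \<Union>(\<V> U)) \<inter> S" using F(3) V by simp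
    also have "\<dots> = \<Union>(\<Union>U\<in>\<U>. \<V> U) \<inter> S" by blast
    finally have "\<Union>(\<Union>U\<in>\<F>. \<G> U) \<inter> S = \<Union>(\<Union>U\<in>\<U>. \<V> U) \<inter> S" .
    moreover have "(\<Union>U\<in>\<F>. \<G> U) \<subseteq> (\<Union>U\<in>\<U>. \<V> U)"
    proof (rule UN_mono[OF F(1)])
      fix U assume "U \<in> \<F>"
      then show "\<G> U \<subseteq> \<V> U" using F(1) G by (meson subsetD)
    qed
    moreover have "finite (\<Union>U\<in>\<F>. \<G> U)"
      using F(2) by (rule finite_UN_I) (use F(1) G in \<open>meson subsetD\<close>)
    ultimately show "\<exists>\<H>. \<H> \<subseteq> (\<Union>U\<in>\<U>. \<V> U) \<and> finite \<H>
        \<and> \<Union>\<H> \<inter> S = \<Union>(\<Union>U\<in>\<U>. \<V> U) \<inter> S"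
      by (intro exI conjI)
  qed
next
  fix \<U> \<V> assume U: "\<U> \<in> EF (compatible_sets X L) L" and V: "\<V> \<subseteq> compatible_sets X L"
    and un: "\<Union>\<U> = \<Union>\<V>" and ref: "\<And>U. U \<in> \<U> \<Longrightarrow> \<exists>V\<in>\<V>. U \<subseteq> V"
  show "\<V> \<in> EF (compatible_sets X L) L"
  proof (rule EF_I[OF V])
    fix S assume S: "S \<in> L"
    obtain \<F> where F: "\<F> \<subseteq> \<U>" "finite \<F>" "\<Union>\<F> \<inter> S = \<Union>\<U> \<inter> S"
      using EF_obtain[OF U S] .
    obtain f where f: "\<And>U. U \<in> \<U> \<Longrightarrow> f U \<in> \<V> \<and> U \<subseteq> f U"
      using ref by metis
    have sub: "f ` \<F> \<subseteq> \<V>" using F(1) f by blast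
    have "\<Union>\<F> \<inter> S \<subseteq> \<Union>(f ` \<F>) \<inter> S" using F(1) f by blast
    then have "\<Union>\<V> \<inter> S \<subseteq> \<Union>(f ` \<F>) \<inter> S" by (simp only: F(3) un)
    moreover have "\<Union>(f ` \<F>) \<inter> S \<subseteq> \<Union>\<V> \<inter> S" using sub by blast
    ultimately have "\<Union>(f ` \<F>) \<inter> S = \<Union>\<V> \<inter> S" by (rule subset_antisym[rotated])
    then show "\<exists>\<G>. \<G> \<subseteq> \<V> \<and> finite \<G> \<and> \<Union>\<G> \<inter> S = \<Union>\<V> \<inter> S"
      using F(2) sub by (intro exI[of _ "f ` \<F>"]) simp
  qed
next
  fix \<U> W assume U: "\<U> \<in> EF (compatible_sets X L) L" and W: "W \<subseteq> \<Union>\<U>"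
    and UW: "\<U> \<inter>\<^sub>1 W \<subseteq> compatible_sets X L"
  have "\<Union>(\<U> \<inter>\<^sub>1 W) = W"
    using W by (simp add: Union_trace1 Int_absorb1)
  then show "W \<in> compatible_sets X L"
    using compatible_Union_EF[OF trace1_in_EF[OF U UW]] by simp
qed

text \<open>Inside \<open>S \<in> L\<close> the one-member subfamily \<open>{S}\<close> has the same union as \<open>L\<close>.\<close>

lemma L_in_EF: "L \<in> EF (compatible_sets X L) L"
proof (rule EF_I[OF subset_compatible_sets])
  fix S assume "S \<in> L"
  then show "\<exists>\<F>. \<F> \<subseteq> L \<and> finite \<F> \<and> \<Union>\<F> \<inter> S = \<Union>L \<inter> S"
    by (intro exI[of _ "{S}"]) (simp add: Int_absorb1 Union_upper)
qed

section \<open>Minimality\<close>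

text \<open>Openness and admissibility are local along an admissible covering. The finite subfamilies
  that witness \<open>EF\<close> inside each member of \<open>L\<close> are admissible in any gts; regularity and
  transitivity along \<open>L\<close> assemble them.\<close>

lemma EF_subset_Cov_if_admissible:
  assumes "gts X Op Cov" and L: "L \<in> Cov"
  shows "EF (compatible_sets X L) L \<subseteq> Cov"
proof
  interpret G: gts X Op Cov by fact
  have LOp: "L \<subseteq> Op" using G.Cov_subsets L by blast
  have open_compat: "W \<in> Op" if W: "W \<in> compatible_sets X L" for W
  proof (rule G.regularity[OF L])
    show "W \<subseteq> \<Union>L" using compatible_sets_subset[OF W] covers by simp
    show "L \<inter>\<^sub>1 W \<subseteq> Op"
      using compatible_sets_Int[OF W] LOp by (auto simp: trace1_eq_image Int_commute)
  qed
  fix \<V> assume V: "\<V> \<in> EF (compatible_sets X L) L"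
  define W where "W = \<Union>\<V>"
  have VOp: "\<V> \<subseteq> Op" using EF_subset[OF V] open_compat by blast
  have WOp: "W \<in> Op" unfolding W_def by (rule open_compat[OF compatible_Union_EF[OF V]])
  \<comment> \<open>Inside each \<open>S \<in> L\<close> a finite, hence admissible, family refines \<open>\<V>\<close> and covers \<open>S \<inter> W\<close>.
    Along the admissible covering \<open>L \<inter>\<^sub>1 W\<close> of \<open>W\<close> these families form an admissible refinement
    of \<open>\<V>\<close> with the same union.\<close>
  have "\<exists>\<H>. \<H> \<in> Cov \<and> \<Union>\<H> = T \<and> (\<forall>H\<in>\<H>. \<exists>V\<in>\<V>. H \<subseteq> V)" if T: "T \<in> L \<inter>\<^sub>1 W" for T
  proof -
    obtain S where S: "S \<in> L" "T = S \<inter> W" using T by (rule mem_trace1E)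
    obtain \<F> where F: "\<F> \<subseteq> \<V>" "finite \<F>" "\<Union>\<F> \<inter> S = \<Union>\<V> \<inter> S"
      using EF_obtain[OF V S(1)] .
    have "\<F> \<inter>\<^sub>1 S \<in> Cov"
      using F(1,2) VOp S(1) LOp by (intro G.stability G.finiteness_Cov) auto
    moreover have "\<Union>(\<F> \<inter>\<^sub>1 S) = T"
      using F(3) S(2) by (simp add: Union_trace1 W_def Int_commute)
    moreover have "\<forall>H\<in>\<F> \<inter>\<^sub>1 S. \<exists>V\<in>\<V>. H \<subseteq> V"
      using F(1) by (auto elim!: mem_trace1E)
    ultimately show ?thesis by blast
  qed
  then obtain \<H> where H: "\<And>T. T \<in> L \<inter>\<^sub>1 W \<Longrightarrow>
      \<H> T \<in> Cov \<and> \<Union>(\<H> T) = T \<and> (\<forall>H\<in>\<H> T. \<exists>V\<in>\<V>. H \<subseteq> V)"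
    by metis
  have cov: "(\<Union>T\<in>L \<inter>\<^sub>1 W. \<H> T) \<in> Cov"
    using G.stability[OF WOp L] H by (intro G.transitivity) auto
  have "W \<subseteq> X" using G.Op_subsets WOp by blast
  have "\<Union>(\<Union>T\<in>L \<inter>\<^sub>1 W. \<H> T) = (\<Union>T\<in>L \<inter>\<^sub>1 W. \<Union>(\<H> T))" by blast
  also have "\<dots> = \<Union>(L \<inter>\<^sub>1 W)" using H by simp
  also have "\<dots> = \<Union>\<V>"
    using \<open>W \<subseteq> X\<close> covers by (auto simp: Union_trace1 W_def)
  finally have un: "\<Union>(\<Union>T\<in>L \<inter>\<^sub>1 W. \<H> T) = \<Union>\<V>" .
  show "\<V> \<in> Cov"
    using G.saturation[OF cov VOp un] H by blast
qed

section \<open>Subspaces\<close>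

lemma locally_small_space_subspace:
  assumes "Y \<subseteq> X"
  shows "locally_small_space Y (L \<inter>\<^sub>1 Y)"
proof
  show "L \<inter>\<^sub>1 Y \<subseteq> Pow Y" by (auto simp: trace1_def)
  show "{} \<in> L \<inter>\<^sub>1 Y" using mem_trace1I[OF empty, of Y] by simp
  show "\<Union>(L \<inter>\<^sub>1 Y) = Y" using assms covers by (auto simp: Union_trace1)
  fix A B assume "A \<in> L \<inter>\<^sub>1 Y" "B \<in> L \<inter>\<^sub>1 Y"
  then obtain A' B' where AB: "A' \<in> L" "B' \<in> L" "A = A' \<inter> Y" "B = B' \<inter> Y"
    by (auto elim!: mem_trace1E)
  have "A \<inter> B = (A' \<inter> B') \<inter> Y" "A \<union> B = (A' \<union> B') \<inter> Y" using AB by blast+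
  then show "A \<inter> B \<in> L \<inter>\<^sub>1 Y" "A \<union> B \<in> L \<inter>\<^sub>1 Y"
    using inter[OF AB(1,2)] union[OF AB(1,2)] by (simp_all add: mem_trace1I)
qed

end

lemma compatible_sets_trace1:
  assumes "U \<in> compatible_sets X L"
  shows "U \<inter> Y \<in> compatible_sets Y (L \<inter>\<^sub>1 Y)"
proof (rule compatible_setsI)
  fix A assume "A \<in> L \<inter>\<^sub>1 Y"
  then obtain A' where A: "A' \<in> L" "A = A' \<inter> Y" by (rule mem_trace1E)
  have "U \<inter> Y \<inter> A = (U \<inter> A') \<inter> Y" using A(2) by blast
  then show "U \<inter> Y \<inter> A \<in> L \<inter>\<^sub>1 Y"
    using compatible_sets_Int[OF assms A(1)] by (simp add: mem_trace1I)
qed simp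

lemma trace_EF_subset:
  "EF (compatible_sets X L) L \<inter>\<^sub>2 Y \<subseteq> EF (compatible_sets Y (L \<inter>\<^sub>1 Y)) (L \<inter>\<^sub>1 Y)"
proof
  fix \<W> assume "\<W> \<in> EF (compatible_sets X L) L \<inter>\<^sub>2 Y"
  then obtain \<U> where U: "\<U> \<in> EF (compatible_sets X L) L" and W: "\<W> = \<U> \<inter>\<^sub>1 Y"
    unfolding trace2_def by blast
  have "\<W> \<subseteq> compatible_sets Y (L \<inter>\<^sub>1 Y)"
    using EF_subset[OF U] compatible_sets_trace1 unfolding W by (blast elim: mem_trace1E)
  moreover have "ess_finite_on \<W> S" if "S \<in> L \<inter>\<^sub>1 Y" for S
    using that U unfolding W EF_def by (auto elim!: mem_trace1E intro: ess_finite_on_trace1)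
  ultimately show "\<W> \<in> EF (compatible_sets Y (L \<inter>\<^sub>1 Y)) (L \<inter>\<^sub>1 Y)"
    unfolding EF_def by blast
qed

theorem theorem2p50:
  fixes X Y :: "'a set" and L :: "'a set set"
  assumes "locally_small_space X L"
    and "Y \<subseteq> X"
  shows "lss_to_gts (lss_subspace (X, L) Y) = gts_subspace (lss_to_gts (X, L)) Y
    \<and> generated_gt Y (EF (compatible_sets X L) L \<inter>\<^sub>2 Y) =
        EF (compatible_sets Y (L \<inter>\<^sub>1 Y)) (L \<inter>\<^sub>1 Y)"
proof -
  interpret S: locally_small_space X L by fact
  interpret T: locally_small_space Y "L \<inter>\<^sub>1 Y"
    by (rule S.locally_small_space_subspace) fact
  let ?\<Psi> = "EF (compatible_sets X L) L \<inter>\<^sub>2 Y"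
  let ?Cov = "EF (compatible_sets Y (L \<inter>\<^sub>1 Y)) (L \<inter>\<^sub>1 Y)"
  have L\<Psi>: "L \<inter>\<^sub>1 Y \<in> ?\<Psi>"
    using S.L_in_EF unfolding trace2_def by blast
  have gen: "generated_gt Y ?\<Psi> = ?Cov"
    unfolding generated_gt_def
  proof (rule Least_equality)
    show "generalized_topology Y ?Cov \<and> ?\<Psi> \<subseteq> ?Cov"
      using T.gts_compatible_EF trace_EF_subset unfolding generalized_topology_def by blast
    fix Cov assume "generalized_topology Y Cov \<and> ?\<Psi> \<subseteq> Cov"
    then show "?Cov \<le> Cov"
      using L\<Psi> T.EF_subset_Cov_if_admissible unfolding generalized_topology_def by blast
  qed
  moreover have "\<Union>?Cov = compatible_sets Y (L \<inter>\<^sub>1 Y)"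
    using gts.Op_eq_Union_Cov[OF T.gts_compatible_EF] by simp
  ultimately show ?thesis by simp
qed

end
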